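(* Let $X$ be a $\varrho$-homogeneous $T_3$ space. Then $X$ has a Noetherian base $\mathcal B^*\subseteq\mathrm{RO}(X)$.
   Context: $\mathrm{RO}(G)$ denotes the family of regular open subsets of an open set $G$ and $\rho(G)=|\mathrm{RO}(G)|$. A space $X$ is $\varrho$-homogeneous if $\rho(B)=\rho(X)$ for every nonempty $B\in\mathrm{RO}(X)$. A Noetherian base is a base containing no infinite strictly $\subseteq$-increasing sequence. *)

theory Defs
  imports "HOL-Analysis.Analysis" "HOL-Library.Equipollence"
begin

definition regular_open_sets :: "'a topology \<Rightarrow> 'a set set" where
  "regular_open_sets X = {U. U \<subseteq> topspace X \<and> X interior_of (X closure_of U) = U}"

definition rho_homogeneous :: "'a topology \<Rightarrow> bool" where
  "rho_homogeneous X \<longleftrightarrow>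
     (\<forall>B \<in> regular_open_sets X. B \<noteq> {} \<longrightarrow>
        regular_open_sets (subtopology X B) \<approx> regular_open_sets X)"

definition is_base :: "'a topology \<Rightarrow> 'a set set \<Rightarrow> bool" where
  "is_base X \<B> \<longleftrightarrow> (\<forall>B\<in>\<B>. openin X B) \<and>
     (\<forall>U x. openin X U \<and> x \<in> U \<longrightarrow> (\<exists>B\<in>\<B>. x \<in> B \<and> B \<subseteq> U))"

definition noetherian_family :: "'a set set \<Rightarrow> bool" where
  "noetherian_family \<B> \<longleftrightarrow> \<not> (\<exists>f :: nat \<Rightarrow> 'a set. (\<forall>n. f n \<in> \<B>) \<and> (\<forall>n. f n \<subset> f (Suc n)))"

end

theory Submission
  imports Defs
begin

text \<open>Fix a well-order on the nonempty regular open sets and inside every such \<open>P\<close> a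
  decreasing chain \<open>P = P\<^sub>0, P\<^sub>1, \<dots>\<close> with \<open>P\<^sub>n\<close> containing, disjointly from \<open>P\<^sub>n\<^sub>+\<^sub>1\<close>,
  two regular open sets \<open>Q\<close> with disjoint closures. For a nonempty regular open \<open>W\<close> let \<open>(P, n)\<close> be
  lexicographically least with \<open>P\<^sub>n \<subseteq> W\<close>, and modify \<open>W\<close> inside one of the two \<open>Q\<close>, replacing \<open>Q\<close> by
  a proper regular open subset that encodes \<open>W\<close>. The least pair of the modified set is \<open>(P, n + 1)\<close>.
  Along an increasing sequence these pairs descend, hence are eventually constant, so eventually two
  members are modified inside the same \<open>Q\<close>; this is impossible if the codes in \<open>Q\<close> are
  pairwise incomparable.

  Such codes exist because \<open>\<rho>\<close>-homogeneity yields an antichain of size \<open>\<rho>(X)\<close> below every \<open>Q\<close>. Pass to a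
  subset that is homogeneous in cellularity and on which a \<open>\<pi>\<close>-base \<open>D\<close> has the least possible size.
  A recursion along \<open>D\<close> gives an antichain of size \<open>|D|\<close> everywhere below, and
  every regular open set is determined by a disjoint subfamily of \<open>D\<close>, which can be spelled out on a
  cellular family of the same size.\<close>

unbundle cardinal_syntax

section \<open>The algebra of regular open sets\<close>

text \<open>For open \<open>A\<close>, the least regular open set containing it; applied to a union
  it is the join in the Boolean algebra of regular open sets.\<close>

definition reg :: "'a topology \<Rightarrow> 'a set \<Rightarrow> 'a set" where
  "reg X A = X interior_of (X closure_of A)"

definition ext :: "'a topology \<Rightarrow> 'a set \<Rightarrow> 'a set" where
  "ext X A = topspace X - X closure_of A"

abbreviation RO :: "'a topology \<Rightarrow> 'a set set" where
  "RO \<equiv> regular_open_sets"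

lemma RO_iff: "U \<in> RO X \<longleftrightarrow> reg X U = U"
proof -
  have "reg X U \<subseteq> topspace X"
    unfolding reg_def by (rule interior_of_subset_topspace)
  then show ?thesis
    unfolding regular_open_sets_def reg_def by auto
qed

lemma RO_openin: "U \<in> RO X \<Longrightarrow> openin X U"
  using openin_interior_of[of X "X closure_of U"] by (simp add: RO_iff reg_def)

lemma RO_subset_topspace: "U \<in> RO X \<Longrightarrow> U \<subseteq> topspace X"
  by (simp add: RO_openin openin_subset)

lemma reg_RO: "reg X A \<in> RO X"
proof -
  have "X closure_of (reg X A) \<subseteq> X closure_of A"
    unfolding reg_def by (intro closure_of_minimal interior_of_subset) simp
  then have "reg X (reg X A) \<subseteq> reg X A"
    unfolding reg_def by (rule interior_of_mono)
  moreover have "reg X A \<subseteq> X closure_of (reg X A)"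
    by (rule closure_of_subset) (simp add: reg_def interior_of_subset_topspace)
  then have "reg X A \<subseteq> reg X (reg X A)"
    by (subst (2) reg_def) (simp add: reg_def interior_of_maximal)
  ultimately show ?thesis
    unfolding RO_iff by (rule subset_antisym)
qed

lemma reg_mono: "A \<subseteq> B \<Longrightarrow> reg X A \<subseteq> reg X B"
  unfolding reg_def by (simp add: closure_of_mono interior_of_mono)

lemma reg_least: "A \<subseteq> U \<Longrightarrow> U \<in> RO X \<Longrightarrow> reg X A \<subseteq> U"
  using reg_mono[of A U X] by (simp add: RO_iff)

lemma subset_reg: "openin X A \<Longrightarrow> A \<subseteq> reg X A"
  unfolding reg_def by (simp add: closure_of_subset interior_of_maximal openin_subset)

lemma RO_empty: "{} \<in> RO X"
  by (simp add: RO_iff reg_def)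

lemma RO_Int:
  assumes "U \<in> RO X" "V \<in> RO X"
  shows "U \<inter> V \<in> RO X"
proof -
  have "reg X (U \<inter> V) \<subseteq> U \<inter> V"
    by (simp add: assms reg_least)
  moreover have "U \<inter> V \<subseteq> reg X (U \<inter> V)"
    by (simp add: RO_openin assms openin_Int subset_reg)
  ultimately show ?thesis
    unfolding RO_iff by (rule subset_antisym)
qed

section \<open>Exteriors as Boolean complements\<close>

lemma openin_ext: "openin X (ext X A)"
  unfolding ext_def by (simp add: openin_diff)

lemma ext_disjoint: "openin X A \<Longrightarrow> ext X A \<inter> A = {}"
  using closure_of_subset[OF openin_subset, of X A] by (auto simp: ext_def)

lemma subset_ext: "openin X V \<Longrightarrow> V \<inter> A = {} \<Longrightarrow> V \<subseteq> ext X A"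
  using openin_subset[of X V] openin_Int_closure_of_eq_empty[of X V A] by (auto simp: ext_def)

lemma ext_RO:
  assumes "openin X A"
  shows "ext X A \<in> RO X"
proof -
  have "reg X (ext X A) \<inter> A \<subseteq> X closure_of (ext X A) \<inter> A"
    unfolding reg_def using interior_of_subset[of X "X closure_of _"] by blast
  moreover have "X closure_of (ext X A) \<inter> A = {}"
    using assms ext_disjoint openin_Int_closure_of_eq_empty
    by (metis inf_commute)
  ultimately have "reg X (ext X A) \<inter> A = {}"
    by blast
  then have "reg X (ext X A) \<subseteq> ext X A"
    by (intro subset_ext) (simp_all add: reg_RO RO_openin)
  then show ?thesis
    unfolding RO_iff using subset_reg[OF openin_ext] by (rule subset_antisym)
qed

text \<open>Separativity of the order: an open \<open>U\<close> missing the exterior of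
  \<open>V\<close> lies in the closure of \<open>V\<close>, hence in its interior, which is
  \<open>V\<close>.\<close>

lemma Int_ext_nonempty:
  assumes "openin X U" "V \<in> RO X" "\<not> U \<subseteq> V"
  shows "U \<inter> ext X V \<noteq> {}"
proof
  assume "U \<inter> ext X V = {}"
  then have "U \<subseteq> X closure_of V"
    using openin_subset[OF assms(1)] by (auto simp: ext_def)
  then have "U \<subseteq> reg X V"
    unfolding reg_def by (simp add: assms(1) interior_of_maximal)
  then show False
    using assms by (simp add: RO_iff)
qed

text \<open>Inside an open \<open>Q\<close> the closure of \<open>A\<close> depends only on
  \<open>Q \<inter> A\<close>. This lets a code be read back from a join of pieces.\<close>

lemma reg_Int_piece:
  assumes Q: "openin X Q" and g: "g \<in> RO X" and eq: "Q \<inter> A = g"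
  shows "Q \<inter> reg X A = g"
proof
  have gQ: "g \<subseteq> Q" and "g \<subseteq> A" using eq by auto
  have "Q \<inter> reg X A \<subseteq> Q \<inter> X closure_of A"
    unfolding reg_def using interior_of_subset[of X "X closure_of _"] by blast
  also have "\<dots> \<subseteq> X closure_of g"
    using openin_Int_closure_of_subset[OF Q, of A] eq by simp
  finally have "Q \<inter> reg X A \<subseteq> X closure_of g" .
  moreover have "openin X (Q \<inter> reg X A)"
    by (simp add: Q RO_openin openin_Int reg_RO)
  ultimately have "Q \<inter> reg X A \<subseteq> reg X g"
    unfolding reg_def by (simp add: interior_of_maximal)
  then show "Q \<inter> reg X A \<subseteq> g"
    using g by (simp add: RO_iff)
  show "g \<subseteq> Q \<inter> reg X A"
    using gQ \<open>g \<subseteq> A\<close> reg_mono[of g A X] g by (auto simp: RO_iff)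
qed

text \<open>Relative to an open set, closure and interior are traces of the ambient ones. Thus
  homogeneity becomes a count of regular open subsets of \<open>B\<close>.\<close>

lemma RO_subtopology:
  assumes B: "B \<in> RO X"
  shows "RO (subtopology X B) = {U \<in> RO X. U \<subseteq> B}"
proof -
  have oB: "openin X B" and sB: "B \<subseteq> topspace X"
    using B RO_openin RO_subset_topspace by blast+
  have reg_sub: "reg (subtopology X B) U = reg X U \<inter> B" for U
    unfolding reg_def closure_of_subtopology_open[OF disjI1[OF oB]]
      interior_of_subtopology_open[OF oB] interior_of_Int interior_of_openin[OF oB]
    by blast
  show ?thesis
  proof (intro set_eqI iffI)
    fix U assume U: "U \<in> RO (subtopology X B)"
    then have UB: "U \<subseteq> B"
      using RO_subset_topspace by fastforce
    moreover have "reg X U \<subseteq> B"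
      using UB B by (rule reg_least)
    ultimately have "reg X U = U"
      using U reg_sub[of U] unfolding RO_iff by blast
    then show "U \<in> {U \<in> RO X. U \<subseteq> B}"
      using UB by (simp add: RO_iff)
  next
    fix U assume "U \<in> {U \<in> RO X. U \<subseteq> B}"
    then show "U \<in> RO (subtopology X B)"
      using reg_sub[of U] by (auto simp: RO_iff)
  qed
qed

section \<open>Antichains indexed by a minimal \<open>\<pi>\<close>-base\<close>

definition below :: "'a topology \<Rightarrow> 'a set \<Rightarrow> 'a set set" where
  "below X c = {U \<in> RO X. U \<noteq> {} \<and> U \<subseteq> c}"

text \<open>Tested on regular open sets only: a dense subset of the Boolean algebra, a notion free
  of separation axioms.\<close>

definition pi_base :: "'a topology \<Rightarrow> 'a set \<Rightarrow> 'a set set \<Rightarrow> bool" where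
  "pi_base X c D \<longleftrightarrow> D \<subseteq> below X c \<and> (\<forall>U\<in>below X c. \<exists>d\<in>D. d \<subseteq> U)"

definition cellular :: "'a topology \<Rightarrow> 'a set \<Rightarrow> 'a set set \<Rightarrow> bool" where
  "cellular X c F \<longleftrightarrow> F \<subseteq> below X c \<and> pairwise disjnt F"

definition atomless :: "'a topology \<Rightarrow> bool" where
  "atomless X \<longleftrightarrow> (\<forall>U\<in>RO X. U \<noteq> {} \<longrightarrow> (\<exists>V\<in>below X U. V \<noteq> U))"

text \<open>The well-order is a cardinal, so an element of \<open>D\<close> has strictly fewer than
  \<open>|D|\<close> predecessors.\<close>

abbreviation earlier :: "'b set \<Rightarrow> 'b \<Rightarrow> 'b set" where
  "earlier D \<equiv> underS (card_of D)"

lemma below_mono: "c \<subseteq> c' \<Longrightarrow> below X c \<subseteq> below X c'"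
  unfolding below_def by auto

lemma belowD: "U \<in> below X c \<Longrightarrow> U \<in> RO X" "U \<in> below X c \<Longrightarrow> U \<noteq> {}"
  "U \<in> below X c \<Longrightarrow> U \<subseteq> c"
  by (auto simp: below_def)

lemma atomless_split:
  assumes "atomless X" "U \<in> RO X" "U \<noteq> {}"
  obtains V W where "V \<in> below X U" "W \<in> below X U" "V \<inter> W = {}"
proof -
  obtain V where V: "V \<in> below X U" "V \<noteq> U"
    using assms unfolding atomless_def by blast
  have oV: "openin X V"
    using V(1) belowD(1) RO_openin by blast
  have "U \<inter> ext X V \<noteq> {}"
  proof (rule Int_ext_nonempty)
    show "openin X U" using assms(2) by (rule RO_openin)
    show "V \<in> RO X" using V(1) by (rule belowD)
    show "\<not> U \<subseteq> V" using V belowD(3) by blast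
  qed
  moreover have "U \<inter> ext X V \<in> RO X"
    by (intro RO_Int ext_RO assms oV)
  ultimately have "U \<inter> ext X V \<in> below X U"
    by (simp add: below_def)
  moreover have "V \<inter> (U \<inter> ext X V) = {}"
    using ext_disjoint[OF oV] by blast
  ultimately show thesis
    using V(1) that by blast
qed

lemma underS_card_of_total:
  assumes "d \<in> D" "d' \<in> D" "d \<noteq> d'"
  shows "d \<in> earlier D d' \<or> d' \<in> earlier D d"
proof -
  have "total_on D |D|"
    using card_of_well_order_on[of D] unfolding order_on_defs by blast
  then show ?thesis
    using assms unfolding total_on_def underS_def by blast
qed

text \<open>Recursion along \<open>D\<close>: at stage \<open>d\<close> fewer than
  \<open>|D|\<close> sets have been chosen, so by minimality they are no pi-base of
  \<open>c\<close>, and some \<open>U\<close> in \<open>below X c\<close> contains none of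
  them.\<close>

lemma escaping_family:
  fixes D :: "'b set" and X :: "'a topology"
  assumes min: "\<And>E. pi_base X c E \<Longrightarrow> |D| \<le>o |E|"
  obtains e where "\<And>d. d \<in> D \<Longrightarrow> e d \<in> below X c"
    and "\<And>d d'. d \<in> D \<Longrightarrow> d' \<in> earlier D d \<Longrightarrow> \<not> e d' \<subseteq> e d"
proof -
  let ?R = "|D| - Id"
  let ?P = "\<lambda>(f :: 'b \<Rightarrow> 'a set) d U. d \<in> D \<longrightarrow> U \<in> below X c \<and> (\<forall>d'\<in>earlier D d. \<not> f d' \<subseteq> U)"
  have underS_D: "d' \<in> D" if "d' \<in> earlier D d" for d d'
    using that FieldI1[of d' d "|D|"] by (simp add: underS_def Field_card_of)
  have wf: "wf ?R"
    using card_of_well_order_on[of D] unfolding well_order_on_def by blast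
  have "\<exists>f. \<forall>d. ?P f d (f d)"
  proof (rule dependent_wf_choice[OF wf])
    fix f g :: "'b \<Rightarrow> 'a set" and d U
    assume eq: "\<And>z. (z, d) \<in> ?R \<Longrightarrow> f z = g z"
    then have "f d' = g d'" if "d' \<in> earlier D d" for d'
      using that by (auto simp: underS_def)
    then show "?P f d U = ?P g d U" by simp
  next
    fix d and f :: "'b \<Rightarrow> 'a set"
    assume IH: "\<And>d'. (d', d) \<in> ?R \<Longrightarrow> ?P f d' (f d')"
    show "\<exists>U. ?P f d U"
    proof (cases "d \<in> D")
      case True
      let ?E = "f ` earlier D d"
      have "|?E| <o |D|"
        using True
        by (intro ordLeq_ordLess_trans[OF card_of_image card_of_underS[OF card_of_Card_order]])
          (simp add: Field_card_of)
      then have "\<not> pi_base X c ?E"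
        using min[of ?E] not_ordLess_ordLeq by metis
      moreover have "?E \<subseteq> below X c"
      proof
        fix E assume "E \<in> ?E"
        then obtain d' where d': "d' \<in> earlier D d" "E = f d'" by blast
        then have "(d', d) \<in> ?R" by (simp add: underS_def)
        from IH[OF this] underS_D[OF d'(1)] show "E \<in> below X c"
          unfolding d'(2) by simp
      qed
      ultimately have "\<exists>U\<in>below X c. \<forall>E\<in>?E. \<not> E \<subseteq> U"
        unfolding pi_base_def by meson
      then show ?thesis by simp metis
    qed simp
  qed
  then obtain f where f: "?P f d (f d)" for d
    by blast
  show thesis
    by (rule that[of f]) (use f in \<open>simp_all\<close>)
qed

text \<open>One half of each member climbs along the well-order of \<^term>\<open>D\<close>, the complement
  of the other half descends, so no two members are comparable.\<close>

lemma antichain_of_pi_weight: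
  assumes X: "atomless X" and c: "c \<in> RO X" "c \<noteq> {}"
    and min: "\<And>U E. U \<in> below X c \<Longrightarrow> pi_base X U E \<Longrightarrow> |D| \<le>o |E|"
  obtains a where "\<And>d. d \<in> D \<Longrightarrow> a d \<in> RO X" "\<And>d. d \<in> D \<Longrightarrow> a d \<subseteq> c"
    and "\<And>d d'. d \<in> D \<Longrightarrow> d' \<in> D \<Longrightarrow> a d \<subseteq> a d' \<Longrightarrow> d = d'"
proof -
  obtain V W where VW: "V \<in> below X c" "W \<in> below X c" "V \<inter> W = {}"
    using atomless_split[OF X c] .
  obtain v where v: "\<And>d. d \<in> D \<Longrightarrow> v d \<in> below X V"
    and v': "\<And>d d'. d \<in> D \<Longrightarrow> d' \<in> earlier D d \<Longrightarrow> \<not> v d' \<subseteq> v d"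
    by (rule escaping_family[OF min[OF VW(1)]]) auto
  obtain w where w: "\<And>d. d \<in> D \<Longrightarrow> w d \<in> below X W"
    and w': "\<And>d d'. d \<in> D \<Longrightarrow> d' \<in> earlier D d \<Longrightarrow> \<not> w d' \<subseteq> w d"
    by (rule escaping_family[OF min[OF VW(2)]]) auto
  \<comment> \<open>Complementing \<open>w d\<close> inside \<open>W\<close> reverses
    inclusions.\<close>
  define k where "k d = W \<inter> ext X (w d)" for d
  define a where "a d = reg X (v d \<union> k d)" for d
  have oV: "openin X V" and oW: "openin X W"
    using VW belowD(1) RO_openin by blast+
  have k: "k d \<in> RO X" "k d \<subseteq> W" if "d \<in> D" for d
    unfolding k_def
    using RO_Int[OF belowD(1)[OF VW(2)] ext_RO[OF RO_openin[OF belowD(1)[OF w[OF that]]]]]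
    by simp_all
  have aV: "V \<inter> a d = v d" if "d \<in> D" for d
    unfolding a_def
  proof (rule reg_Int_piece[OF oV belowD(1)[OF v[OF that]]])
    show "V \<inter> (v d \<union> k d) = v d"
      using belowD(3)[OF v[OF that]] k(2)[OF that] VW(3) by blast
  qed
  have aW: "W \<inter> a d = k d" if "d \<in> D" for d
    unfolding a_def
  proof (rule reg_Int_piece[OF oW k(1)[OF that]])
    show "W \<inter> (v d \<union> k d) = k d"
      using belowD(3)[OF v[OF that]] k(2)[OF that] VW(3) by blast
  qed
  \<comment> \<open>Otherwise \<open>w d'\<close> meets the exterior of \<open>w d\<close>; the
    intersection lies in \<open>k d\<close>, hence in \<open>k d'\<close>, which is disjoint from
    \<open>w d'\<close>.\<close>
  have k_mono: "w d' \<subseteq> w d" if d: "d \<in> D" "d' \<in> D" and sub: "k d \<subseteq> k d'" for d d'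
  proof (rule ccontr)
    assume "\<not> w d' \<subseteq> w d"
    then have "w d' \<inter> ext X (w d) \<noteq> {}"
      using w[OF d(1)] w[OF d(2)] by (intro Int_ext_nonempty) (auto simp: below_def RO_openin)
    moreover have "w d' \<inter> ext X (w d) \<subseteq> k d"
      unfolding k_def using belowD(3)[OF w[OF d(2)]] by blast
    ultimately have "w d' \<inter> ext X (w d') \<noteq> {}"
      using sub unfolding k_def by blast
    then show False
      using ext_disjoint[of X "w d'"] w[OF d(2)] belowD(1) RO_openin by blast
  qed
  show thesis
  proof
    show "a d \<in> RO X" for d
      unfolding a_def by (rule reg_RO)
    show "a d \<subseteq> c" if "d \<in> D" for d
      unfolding a_def using v[OF that] k(2)[OF that] VW belowD(3) c(1)
      by (intro reg_least) blast+
    show "d = d'" if d: "d \<in> D" "d' \<in> D" and sub: "a d \<subseteq> a d'" for d d'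
    proof (rule ccontr)
      assume "d \<noteq> d'"
      moreover have "v d \<subseteq> v d'"
        using aV[OF d(1)] aV[OF d(2)] sub by blast
      moreover have "w d' \<subseteq> w d"
        using aW[OF d(1)] aW[OF d(2)] sub k_mono[OF d] by blast
      \<comment> \<open>If \<open>d\<close> precedes \<open>d'\<close>, the inclusion of the
        \<open>v\<close> parts is excluded; in the other order, that of the \<open>w\<close>
        parts.\<close>
      ultimately show False
        using underS_card_of_total[OF d] v'[OF d(2), of d] w'[OF d(1), of d'] by blast
    qed
  qed
qed

text \<open>Take a maximal disjoint family of members of \<open>D\<close> below \<open>u\<close>. If
  its join missed part of \<open>u\<close>, density would give a further member of \<open>D\<close>
  in the exterior of the join.\<close>

lemma disjoint_decomposition:
  assumes D: "pi_base X c D" and u: "u \<in> RO X" "u \<subseteq> c"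
  obtains F where "F \<subseteq> D" "pairwise disjnt F" "reg X (\<Union>F) = u"
proof -
  let ?\<A> = "{F. F \<subseteq> {d \<in> D. d \<subseteq> u} \<and> pairwise disjnt F}"
  have "\<exists>F\<in>?\<A>. \<forall>G\<in>?\<A>. F \<subseteq> G \<longrightarrow> G = F"
  proof (rule subset_Zorn')
    fix C assume C: "subset.chain ?\<A> C"
    have "pairwise disjnt (\<Union>C)"
      using C unfolding subset_chain_def
      by (intro pairwise_chain_Union) (auto simp: chain_subset_def)
    then show "\<Union>C \<in> ?\<A>"
      using C unfolding subset_chain_def by blast
  qed
  then obtain F where FA: "F \<in> ?\<A>" and max: "\<forall>G\<in>?\<A>. F \<subseteq> G \<longrightarrow> G = F" ..
  then have F: "F \<subseteq> {d \<in> D. d \<subseteq> u}" "pairwise disjnt F"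
    by simp_all
  have DR: "D \<subseteq> RO X" "{} \<notin> D"
    using D unfolding pi_base_def below_def by auto
  have oF: "openin X (\<Union>F)"
    using F(1) DR RO_openin by blast
  have Fu: "reg X (\<Union>F) \<subseteq> u"
    using F(1) u(1) by (intro reg_least) auto
  moreover have "u \<subseteq> reg X (\<Union>F)"
  proof (rule ccontr)
    assume "\<not> u \<subseteq> reg X (\<Union>F)"
    then have "u \<inter> ext X (reg X (\<Union>F)) \<noteq> {}"
      using u(1) by (intro Int_ext_nonempty reg_RO RO_openin)
    then have "u \<inter> ext X (reg X (\<Union>F)) \<in> below X c"
      unfolding below_def using u by (auto intro!: RO_Int ext_RO RO_openin reg_RO)
    then obtain d where d: "d \<in> D" "d \<subseteq> u \<inter> ext X (reg X (\<Union>F))"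
      using D unfolding pi_base_def by blast
    have "ext X (reg X (\<Union>F)) \<inter> reg X (\<Union>F) = {}"
      by (intro ext_disjoint RO_openin reg_RO)
    then have disj: "d \<inter> \<Union>F = {}"
      using d(2) subset_reg[OF oF] by blast
    then have "insert d F \<in> ?\<A>"
      using F d by (auto simp: pairwise_insert disjnt_def)
    with max have "insert d F = F"
      by (meson subset_insertI)
    then have "d \<in> F"
      by blast
    then show False
      using disj d(1) DR(2) Union_upper[of d F] by (simp add: inf_absorb1)
  qed
  ultimately show thesis
    using that F by blast
qed

section \<open>Antichains of full cardinality\<close>

text \<open>If every set below \<open>q\<close> fails, take a failure \<open>b\<close>,
  \<open>F\<close> with \<open>|F|\<close> least. Some \<open>c\<close> below \<open>b\<close>
  carries no cellular family as large as \<open>F\<close>; but \<open>c\<close> fails too, and its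
  witness is such a family.\<close>

lemma exists_saturation_homogeneous:
  assumes q: "q \<in> RO X" "q \<noteq> {}"
  obtains b where "b \<in> below X q"
    and "\<And>c F. c \<in> below X b \<Longrightarrow> cellular X b F \<Longrightarrow> \<exists>G. cellular X c G \<and> |F| \<le>o |G|"
proof -
  define bad where "bad b F \<longleftrightarrow> b \<in> below X q \<and> cellular X b F \<and>
      (\<exists>c\<in>below X b. \<forall>G. cellular X c G \<longrightarrow> \<not> |F| \<le>o |G| )" for b F
  have "\<exists>b\<in>below X q. \<forall>F. \<not> bad b F"
  proof (rule ccontr)
    assume contra: "\<not> ?thesis"
    let ?S = "{|F| |F. \<exists>b. bad b F}"
    have "q \<in> below X q"
      using q by (simp add: below_def)
    then obtain F0 where "bad q F0"
      using contra by blast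
    then have "?S \<noteq> {}" by blast
    moreover have "\<forall>r\<in>?S. Card_order r"
      using card_of_Card_order by blast
    ultimately have "\<exists>r\<in>?S. \<forall>r'\<in>?S. r \<le>o r'"
      by (rule exists_minim_Card_order)
    then obtain b F where bF: "bad b F" and min: "\<And>b' G. bad b' G \<Longrightarrow> |F| \<le>o |G|"
      by blast
    then obtain c where c: "c \<in> below X b" "\<And>G. cellular X c G \<Longrightarrow> \<not> |F| \<le>o |G|"
      unfolding bad_def by blast
    have "c \<in> below X q"
      using c(1) bF unfolding bad_def below_def by blast
    then obtain G where G: "bad c G"
      using contra by blast
    then show False
      using min[OF G] c(2)[of G] unfolding bad_def by blast
  qed
  then obtain b where b: "b \<in> below X q" and good: "\<And>F. \<not> bad b F"
    by blast
  show thesis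
  proof (rule that[OF b])
    fix c F assume "c \<in> below X b" "cellular X b F"
    then show "\<exists>G. cellular X c G \<and> |F| \<le>o |G|"
      using good[of F] b unfolding bad_def by blast
  qed
qed

text \<open>Minimise \<open>|D|\<close> over all \<open>c\<close> below \<open>q\<close> at once;
  sets below \<open>c\<close> are among the competitors.\<close>

lemma exists_pi_weight_homogeneous:
  assumes q: "q \<in> RO X" "q \<noteq> {}"
  obtains c D where "c \<in> below X q" "pi_base X c D"
    and "\<And>U E. U \<in> below X c \<Longrightarrow> pi_base X U E \<Longrightarrow> |D| \<le>o |E|"
proof -
  let ?S = "{|D| |D. \<exists>c\<in>below X q. pi_base X c D}"
  have "q \<in> below X q" "pi_base X q (below X q)"
    using q by (auto simp: below_def pi_base_def)
  then have "?S \<noteq> {}" by blast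
  moreover have "\<forall>r\<in>?S. Card_order r"
    using card_of_Card_order by blast
  ultimately have "\<exists>r\<in>?S. \<forall>r'\<in>?S. r \<le>o r'"
    by (rule exists_minim_Card_order)
  then obtain c D where cD: "c \<in> below X q" "pi_base X c D"
    and min: "\<And>U E. U \<in> below X q \<Longrightarrow> pi_base X U E \<Longrightarrow> |D| \<le>o |E|"
    by blast
  have sub: "below X c \<subseteq> below X q"
    by (rule below_mono[OF belowD(3)[OF cD(1)]])
  show thesis
    by (rule that[OF cD]) (rule min[OF subsetD[OF sub]])
qed

text \<open>A smaller cardinal is isomorphic to a proper initial segment, so elements of
  \<open>D\<close> can name all cardinals below \<open>|D|\<close>.\<close>

lemma ordLess_card_of_earlier:
  assumes "|F| <o |D|"
  obtains a where "a \<in> D" "|F| =o |earlier D a|"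
proof -
  obtain a where a: "a \<in> D" "|F| =o Restr (card_of D) (earlier D a)"
    using assms ordLess_iff_ordIso_Restr[OF card_of_Well_order card_of_Well_order]
    by (metis Field_card_of)
  have "wo_rel |D|"
    by (simp add: wo_rel_def card_of_Well_order)
  then have "Field (Restr (card_of D) (earlier D a)) = earlier D a"
    by (intro Field_Restr_ofilter[OF card_of_Well_order] wo_rel.underS_ofilter)
  then have "|F| =o |earlier D a|"
    using card_of_cong[OF a(2)] by (simp add: Field_card_of)
  with a(1) show thesis by (rule that)
qed

text \<open>\<^term>\<open>t\<close> records the cardinality of a cellular family by an element of \<^term>\<open>D\<close>,
  because the supremum of these cardinalities need not be attained.\<close>

lemma cellular_size_code:
  assumes D: "D \<noteq> {}"
    and hom: "\<And>F. cellular X c F \<Longrightarrow> \<exists>G. cellular X b G \<and> |F| \<le>o |G|"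
  obtains t I where "\<And>F. cellular X c F \<Longrightarrow> F \<subseteq> D \<Longrightarrow>
      t F \<in> D \<and> cellular X b (I (t F)) \<and> |F| \<le>o |I (t F)|"
proof (cases "\<exists>F. cellular X c F \<and> |D| \<le>o |F|")
  case True
  then obtain F where F: "cellular X c F" "|D| \<le>o |F|" by blast
  obtain G where G: "cellular X b G" "|F| \<le>o |G|"
    using hom[OF F(1)] by blast
  obtain d where d: "d \<in> D" using D by blast
  \<comment> \<open>One family of size at least \<open>|D|\<close> serves every subfamily of
    \<open>D\<close>, so a constant code suffices.\<close>
  show thesis
  proof (rule that[of "\<lambda>_. d" "\<lambda>_. G"])
    fix F' assume "F' \<subseteq> D"
    then have "|F'| \<le>o |G|"
      by (intro ordLeq_transitive[OF card_of_mono1 ordLeq_transitive[OF F(2) G(2)]])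
    then show "d \<in> D \<and> cellular X b G \<and> |F'| \<le>o |G|"
      using d G(1) by simp
  qed
next
  case False
  \<comment> \<open>Every cellular family in \<open>c\<close> is now smaller than \<open>D\<close>.
    The cells returned by \<open>I\<close> depend on the code alone, so equal codes give equal
    cells.\<close>
  define t where "t F = (SOME a. a \<in> D \<and> |F| =o |earlier D a| )" for F :: "'a set set"
  define I where "I a = (SOME G. cellular X b G \<and> |earlier D a| \<le>o |G| )" for a
  show thesis
  proof (rule that[of t I])
    fix F assume F: "cellular X c F" "F \<subseteq> D"
    have "|F| <o |D|"
      using False F(1) not_ordLeq_iff_ordLess[OF card_of_Well_order card_of_Well_order] by blast
    then have "\<exists>a. a \<in> D \<and> |F| =o |earlier D a|"
      by (rule ordLess_card_of_earlier) blast
    then have "t F \<in> D \<and> |F| =o |earlier D (t F)|"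
      unfolding t_def by (rule someI_ex)
    then have t: "t F \<in> D" "|F| =o |earlier D (t F)|"
      by simp_all
    obtain G where "cellular X b G" "|F| \<le>o |G|"
      using hom[OF F(1)] by blast
    then have "\<exists>G. cellular X b G \<and> |earlier D (t F)| \<le>o |G|"
      using ordIso_ordLeq_trans[OF ordIso_symmetric[OF t(2)]] by blast
    then have "cellular X b (I (t F)) \<and> |earlier D (t F)| \<le>o |I (t F)|"
      unfolding I_def by (rule someI_ex)
    then show "t F \<in> D \<and> cellular X b (I (t F)) \<and> |F| \<le>o |I (t F)|"
      using t(1) ordIso_ordLeq_trans[OF t(2), of "|I (t F)|"] by simp
  qed
qed

text \<open>A member \<^term>\<open>u\<close> is the join of a disjoint subfamily of a minimal \<open>\<pi>\<close>-base; that
  subfamily is spread over an equally large cellular family, using an antichain inside every cell.\<close>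

lemma antichain_of_full_size:
  assumes X: "atomless X" and q: "q \<in> RO X" "q \<noteq> {}"
  obtains c h where "c \<in> below X q" "\<And>u. u \<in> below X c \<Longrightarrow> h u \<in> RO X \<and> h u \<subseteq> q"
    and "\<And>u v. u \<in> below X c \<Longrightarrow> v \<in> below X c \<Longrightarrow> h u \<subseteq> h v \<Longrightarrow> u = v"
proof -
  obtain b where b: "b \<in> below X q"
    and sat: "\<And>c F. c \<in> below X b \<Longrightarrow> cellular X b F \<Longrightarrow> \<exists>G. cellular X c G \<and> |F| \<le>o |G|"
    using exists_saturation_homogeneous[OF q] by blast
  obtain c D where c: "c \<in> below X b" and D: "pi_base X c D"
    and min: "\<And>U E. U \<in> below X c \<Longrightarrow> pi_base X U E \<Longrightarrow> |D| \<le>o |E|"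
    using exists_pi_weight_homogeneous[OF belowD(1)[OF b] belowD(2)[OF b]] by blast
  \<comment> \<open>\<open>V\<close> will hold the cardinality code and \<open>W\<close> the
    subfamily of \<open>D\<close>.\<close>
  obtain V W where VW: "V \<in> below X c" "W \<in> below X c" "V \<inter> W = {}"
    using atomless_split[OF X belowD(1)[OF c] belowD(2)[OF c]] .
  have cc: "c \<in> below X c"
    using c by (simp add: below_def)
  have D_ne: "D \<noteq> {}"
    using D cc unfolding pi_base_def by blast
  have bcq: "below X c \<subseteq> below X b"
    by (rule below_mono[OF belowD(3)[OF c]])
  have "\<exists>G. cellular X W G \<and> |F| \<le>o |G|" if "cellular X c F" for F
    using sat[of W F] VW(2) bcq that unfolding cellular_def by blast
  then obtain t I where tI: "\<And>F. cellular X c F \<Longrightarrow> F \<subseteq> D \<Longrightarrow>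
      t F \<in> D \<and> cellular X W (I (t F)) \<and> |F| \<le>o |I (t F)|"
    using cellular_size_code[OF D_ne, of X c W] by metis
  have anti: "\<exists>a. (\<forall>d\<in>D. a d \<in> RO X \<and> a d \<subseteq> U) \<and> (\<forall>d\<in>D. \<forall>d'\<in>D. a d \<subseteq> a d' \<longrightarrow> d = d')"
    if U: "U \<in> below X c" for U
  proof -
    have "below X U \<subseteq> below X c"
      by (rule below_mono[OF belowD(3)[OF U]])
    then have m: "|D| \<le>o |E|" if "U' \<in> below X U" "pi_base X U' E" for U' E
      using that min[of U' E] by blast
    show ?thesis
    proof (rule antichain_of_pi_weight[OF X belowD(1)[OF U] belowD(2)[OF U] m])
      fix a assume "\<And>d. d \<in> D \<Longrightarrow> a d \<in> RO X" "\<And>d. d \<in> D \<Longrightarrow> a d \<subseteq> U"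
        "\<And>d d'. d \<in> D \<Longrightarrow> d' \<in> D \<Longrightarrow> a d \<subseteq> a d' \<Longrightarrow> d = d'"
      then show ?thesis by (intro exI[of _ a]) simp
    qed
  qed
  have "\<exists>a. \<forall>U\<in>below X c. (\<forall>d\<in>D. a U d \<in> RO X \<and> a U d \<subseteq> U) \<and>
      (\<forall>d\<in>D. \<forall>d'\<in>D. a U d \<subseteq> a U d' \<longrightarrow> d = d')"
    by (rule bchoice) (use anti in simp)
  then obtain a where "\<forall>U\<in>below X c. (\<forall>d\<in>D. a U d \<in> RO X \<and> a U d \<subseteq> U) \<and>
      (\<forall>d\<in>D. \<forall>d'\<in>D. a U d \<subseteq> a U d' \<longrightarrow> d = d')" ..
  then have a: "\<And>U d. U \<in> below X c \<Longrightarrow> d \<in> D \<Longrightarrow> a U d \<in> RO X \<and> a U d \<subseteq> U"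
    and a_inj: "\<And>U d d'. U \<in> below X c \<Longrightarrow> d \<in> D \<Longrightarrow> d' \<in> D \<Longrightarrow> a U d \<subseteq> a U d' \<Longrightarrow> d = d'"
    by simp_all
  have "\<exists>F. F \<subseteq> D \<and> pairwise disjnt F \<and> reg X (\<Union>F) = u" if "u \<in> below X c" for u
    by (rule disjoint_decomposition[OF D belowD(1)[OF that] belowD(3)[OF that]]) blast
  then have "\<exists>F. \<forall>u\<in>below X c. F u \<subseteq> D \<and> pairwise disjnt (F u) \<and> reg X (\<Union>(F u)) = u"
    by (intro bchoice) simp
  then obtain F where "\<forall>u\<in>below X c. F u \<subseteq> D \<and> pairwise disjnt (F u) \<and> reg X (\<Union>(F u)) = u" ..
  then have F: "\<And>u. u \<in> below X c \<Longrightarrow> F u \<subseteq> D"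
    "\<And>u. u \<in> below X c \<Longrightarrow> pairwise disjnt (F u)" "\<And>u. u \<in> below X c \<Longrightarrow> reg X (\<Union>(F u)) = u"
    by simp_all
  have Fcell: "cellular X c (F u)" if "u \<in> below X c" for u
    using F(1,2)[OF that] D unfolding cellular_def pi_base_def by blast
  define J where "J u = I (t (F u))" for u
  have tD: "t (F u) \<in> D" and Jcell: "cellular X W (J u)" and Jle: "|F u| \<le>o |J u|"
    if "u \<in> below X c" for u
    using tI[OF Fcell[OF that] F(1)[OF that]] by (simp_all add: J_def)
  have "\<exists>f. f ` J u = F u" if u: "u \<in> below X c" for u
  proof -
    \<comment> \<open>Only onto a nonempty set does the cardinal inequality yield a
      surjection.\<close>
    have "F u \<noteq> {}"
    proof
      assume "F u = {}"
      then have "u = reg X {}" using F(3)[OF u] by simp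
      then show False
        using belowD(2)[OF u] RO_empty[of X] by (simp add: RO_iff)
    qed
    then show ?thesis
      by (rule iffD2[OF card_of_ordLeq2 Jle[OF u]])
  qed
  then have "\<exists>f. \<forall>u\<in>below X c. f u ` J u = F u"
    by (intro bchoice) simp
  then obtain f where "\<forall>u\<in>below X c. f u ` J u = F u" ..
  then have f: "\<And>u. u \<in> below X c \<Longrightarrow> f u ` J u = F u"
    by simp
  have fD: "f u i \<in> D" if "u \<in> below X c" "i \<in> J u" for u i
    using f[OF that(1)] F(1)[OF that(1)] that(2) by blast
  have JW: "i \<in> below X W" if "u \<in> below X c" "i \<in> J u" for u i
    using Jcell[OF that(1)] that(2) unfolding cellular_def by blast
  have Jc: "i \<in> below X c" if "u \<in> below X c" "i \<in> J u" for u i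
    using JW[OF that] below_mono[OF belowD(3)[OF VW(2)]] by blast
  define K where "K u = (\<Union>i\<in>J u. a i (f u i))" for u
  define h where "h u = reg X (a V (t (F u)) \<union> K u)" for u
  have aiW: "a i (f u i) \<subseteq> i" "i \<subseteq> W" if "u \<in> below X c" "i \<in> J u" for u i
    using a[OF Jc[OF that] fD[OF that]] belowD(3)[OF JW[OF that]] by simp_all
  have KW: "K u \<subseteq> W" if "u \<in> below X c" for u
    unfolding K_def using aiW[OF that] by blast
  have aV: "a V (t (F u)) \<in> RO X" "a V (t (F u)) \<subseteq> V" if "u \<in> below X c" for u
    using a[OF VW(1) tD[OF that]] by simp_all
  have hV: "V \<inter> h u = a V (t (F u))" if u: "u \<in> below X c" for u
    unfolding h_def
  proof (rule reg_Int_piece[OF RO_openin[OF belowD(1)[OF VW(1)]] aV(1)[OF u]])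
    show "V \<inter> (a V (t (F u)) \<union> K u) = a V (t (F u))"
      using aV(2)[OF u] KW[OF u] VW(3) by blast
  qed
  have hi: "i \<inter> h u = a i (f u i)" if u: "u \<in> below X c" and i: "i \<in> J u" for u i
    unfolding h_def
  proof (rule reg_Int_piece[OF RO_openin[OF belowD(1)[OF Jc[OF u i]]]])
    show "a i (f u i) \<in> RO X"
      using a[OF Jc[OF u i] fD[OF u i]] by simp
    have "i \<inter> a j (f u j) = {}" if j: "j \<in> J u" "j \<noteq> i" for j
    proof -
      have "disjnt i j"
        using Jcell[OF u] i j unfolding cellular_def pairwise_def by blast
      then show ?thesis
        using aiW(1)[OF u j(1)] unfolding disjnt_def by blast
    qed
    then have "i \<inter> K u = a i (f u i)"
      unfolding K_def using i aiW(1)[OF u i] by blast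
    then show "i \<inter> (a V (t (F u)) \<union> K u) = a i (f u i)"
      using aV(2)[OF u] aiW(2)[OF u i] VW(3) by blast
  qed
  show thesis
  proof (rule that[of c h])
    show "c \<in> below X q"
      using c below_mono[OF belowD(3)[OF b]] by blast
  next
    fix u assume u: "u \<in> below X c"
    have "c \<subseteq> q" using belowD(3)[OF c] belowD(3)[OF b] by blast
    then have "a V (t (F u)) \<union> K u \<subseteq> q"
      using aV(2)[OF u] KW[OF u] belowD(3)[OF VW(1)] belowD(3)[OF VW(2)] by blast
    then show "h u \<in> RO X \<and> h u \<subseteq> q"
      unfolding h_def using reg_RO reg_least q(1) by blast
  next
    fix u v assume u: "u \<in> below X c" and v: "v \<in> below X c" and sub: "h u \<subseteq> h v"
    \<comment> \<open>The trace on \<open>V\<close> is decoded first: it shows that \<open>u\<close>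
      and \<open>v\<close> use the same cells, whose traces can then be compared one by one.\<close>
    have "a V (t (F u)) \<subseteq> a V (t (F v))"
      using hV[OF u] hV[OF v] sub by blast
    then have "t (F u) = t (F v)"
      by (rule a_inj[OF VW(1) tD[OF u] tD[OF v]])
    then have J: "J u = J v" by (simp add: J_def)
    have "f u i = f v i" if i: "i \<in> J u" for i
    proof -
      have i': "i \<in> J v" using i J by simp
      have "a i (f u i) \<subseteq> a i (f v i)"
        using hi[OF u i] hi[OF v i'] sub by blast
      then show ?thesis
        by (rule a_inj[OF Jc[OF u i] fD[OF u i] fD[OF v i']])
    qed
    then have "F u = F v"
      using f[OF u] f[OF v] J by (metis image_cong)
    then have "reg X (\<Union>(F u)) = reg X (\<Union>(F v))"
      by (rule arg_cong)
    then show "u = v"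
      unfolding F(3)[OF u] F(3)[OF v] .
  qed
qed

section \<open>Noetherian bases\<close>

lemma RO_below_eqpoll:
  assumes "rho_homogeneous X" "U \<in> RO X" "U \<noteq> {}"
  shows "insert {} (below X U) \<approx> RO X"
proof -
  have "insert {} (below X U) = RO (subtopology X U)"
    unfolding RO_subtopology[OF assms(2)] below_def using RO_empty[of X] by blast
  then show ?thesis
    using assms unfolding rho_homogeneous_def by simp
qed

lemma infinite_below:
  assumes "rho_homogeneous X" "infinite (RO X)" "U \<in> RO X" "U \<noteq> {}"
  shows "infinite (below X U)"
  using RO_below_eqpoll[OF assms(1,3,4)] assms(2) eqpoll_finite_iff finite_insert by metis

text \<open>An atom has only itself below it, while homogeneity puts infinitely many sets
  there.\<close>

lemma infinite_homogeneous_atomless: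
  assumes "rho_homogeneous X" "infinite (RO X)"
  shows "atomless X"
  unfolding atomless_def
proof (intro ballI impI)
  fix U assume "U \<in> RO X" "U \<noteq> {}"
  then have "infinite (below X U)"
    by (rule infinite_below[OF assms])
  then have "\<not> below X U \<subseteq> {U}"
    using finite_subset by blast
  then show "\<exists>V\<in>below X U. V \<noteq> U"
    by blast
qed

text \<open>By homogeneity \<open>below X c\<close> has the size of \<open>RO X\<close>, the empty
  set being negligible at infinite size. Codes for \<open>below X c\<close> are thus reindexed by
  all regular open sets.\<close>

lemma RO_antichain_code:
  assumes X: "rho_homogeneous X" "infinite (RO X)" and q: "q \<in> RO X" "q \<noteq> {}"
  shows "\<exists>h. \<forall>u\<in>RO X. h u \<in> RO X \<and> h u \<subseteq> q \<and> (\<forall>v\<in>RO X. h u \<subseteq> h v \<longrightarrow> u = v)"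
proof -
  obtain c h where c: "c \<in> below X q" and h: "\<And>u. u \<in> below X c \<Longrightarrow> h u \<in> RO X \<and> h u \<subseteq> q"
    and anti: "\<And>u v. u \<in> below X c \<Longrightarrow> v \<in> below X c \<Longrightarrow> h u \<subseteq> h v \<Longrightarrow> u = v"
    using antichain_of_full_size[OF infinite_homogeneous_atomless[OF X] q] by blast
  have "RO X \<approx> insert {} (below X c)"
    by (rule eqpoll_sym[OF RO_below_eqpoll[OF X(1) belowD(1)[OF c] belowD(2)[OF c]]])
  also have "insert {} (below X c) \<approx> below X c"
    by (rule infinite_insert_eqpoll[OF infinite_below[OF X belowD(1)[OF c] belowD(2)[OF c]]])
  finally obtain g where g: "bij_betw g (RO X) (below X c)"
    unfolding eqpoll_def by blast
  have gb: "g u \<in> below X c" if "u \<in> RO X" for u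
    using g that by (rule bij_betw_apply)
  show ?thesis
  proof (intro exI[of _ "\<lambda>u. h (g u)"] ballI conjI impI)
    fix u assume u: "u \<in> RO X"
    show "h (g u) \<in> RO X" "h (g u) \<subseteq> q"
      using h[OF gb[OF u]] by simp_all
    fix v assume v: "v \<in> RO X" "h (g u) \<subseteq> h (g v)"
    then have "g u = g v"
      by (intro anti gb u)
    then show "u = v"
      using g u v(1) by (meson bij_betw_def inj_onD)
  qed
qed

section \<open>Separation in regular spaces\<close>

lemma regular_space_RO_base:
  assumes X: "regular_space X" and U: "openin X U" "x \<in> U"
  obtains W where "W \<in> RO X" "x \<in> W" "X closure_of W \<subseteq> U"
proof -
  have "neighbourhood_base_of (closedin X) X"
    using X by (simp add: neighbourhood_base_of_closedin)
  then obtain V K where VK: "openin X V" "closedin X K" "x \<in> V" "V \<subseteq> K" "K \<subseteq> U"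
    using U unfolding neighbourhood_base_of by meson
  have "reg X V \<subseteq> X closure_of V"
    unfolding reg_def by (rule interior_of_subset)
  also have "\<dots> \<subseteq> K"
    using VK by (intro closure_of_minimal)
  finally have "X closure_of (reg X V) \<subseteq> U"
    using closure_of_minimal[OF _ VK(2)] VK(5) by blast
  moreover have "x \<in> reg X V"
    using subset_reg[OF VK(1)] VK(3) by blast
  ultimately show thesis
    using that reg_RO by blast
qed

lemma RO_subset_closure: "W \<in> RO X \<Longrightarrow> W \<subseteq> X closure_of W"
  by (simp add: RO_subset_topspace closure_of_subset)

text \<open>Two splittings give disjoint \<open>N\<close>, \<open>A\<close>, \<open>B\<close>.
  Shrinking \<open>A\<close> alone to \<open>C\<close> separates the closures, since the open set
  \<open>A\<close> misses the closure of \<open>B\<close>.\<close>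

lemma three_pieces:
  assumes X: "regular_space X" "atomless X" and P: "P \<in> RO X" "P \<noteq> {}"
  obtains N q where "N \<in> below X P" "\<And>i. q i \<in> below X P" "\<And>i. N \<inter> q i = {}"
    "X closure_of q True \<inter> X closure_of q False = {}"
proof -
  obtain N V where NV: "N \<in> below X P" "V \<in> below X P" "N \<inter> V = {}"
    using atomless_split[OF X(2) P] .
  obtain A B where AB: "A \<in> below X V" "B \<in> below X V" "A \<inter> B = {}"
    using atomless_split[OF X(2) belowD(1)[OF NV(2)] belowD(2)[OF NV(2)]] .
  have oA: "openin X A" using AB(1) by (intro RO_openin belowD)
  obtain x where "x \<in> A" using belowD(2)[OF AB(1)] by blast
  then obtain C where C: "C \<in> RO X" "x \<in> C" "X closure_of C \<subseteq> A"
    using regular_space_RO_base[OF X(1) oA] by metis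
  have CA: "C \<subseteq> A"
    using RO_subset_closure[OF C(1)] C(3) by (rule subset_trans)
  have "A \<inter> X closure_of B = {}"
    using openin_Int_closure_of_eq_empty[OF oA] AB(3) by blast
  then have disj: "X closure_of C \<inter> X closure_of B = {}"
    using C(3) by blast
  have "C \<in> below X V"
    using C(1,2) CA belowD(3)[OF AB(1)] unfolding below_def by blast
  then have q: "(if i then C else B) \<in> below X V" for i
    using AB(2) by simp
  show thesis
  proof (rule that[of N "\<lambda>i. if i then C else B"])
    show "N \<in> below X P" by (rule NV)
    show "(if i then C else B) \<in> below X P" for i
      using q[of i] below_mono[OF belowD(3)[OF NV(2)]] by (rule rev_subsetD)
    show "N \<inter> (if i then C else B) = {}" for i
      using belowD(3)[OF q[of i]] NV(3) by blast
    show "X closure_of (if True then C else B) \<inter> X closure_of (if False then C else B) = {}"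
      using disj by simp
  qed
qed

text \<open>A minimal value of the range, once reached, cannot be left.\<close>

lemma wf_descending_stabilises:
  assumes wf: "wf R" and step: "\<And>k. (s (Suc k), s k) \<in> R \<or> s (Suc k) = s k"
  obtains N where "\<And>k. k \<ge> N \<Longrightarrow> s k = s N"
proof -
  have "s 0 \<in> range s" by simp
  then obtain z where z: "z \<in> range s" "\<And>y. (y, z) \<in> R \<Longrightarrow> y \<notin> range s"
    using wfE_min[OF wf] by metis
  then obtain N where N: "z = s N" by blast
  have "s k = s N" if "k \<ge> N" for k
    using that
  proof (induction k rule: dec_induct)
    case (step k)
    then show ?case
      using \<open>\<And>k. (s (Suc k), s k) \<in> R \<or> s (Suc k) = s k\<close>[of k] z(2)[of "s (Suc k)"] N by auto
  qed simp
  with that show thesis by blast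
qed

section \<open>Construction of the base\<close>

lemma finite_noetherian_family: "finite \<B> \<Longrightarrow> noetherian_family \<B>"
  unfolding noetherian_family_def
proof
  assume fin: "finite \<B>" and "\<exists>f :: nat \<Rightarrow> 'a set. (\<forall>n. f n \<in> \<B>) \<and> (\<forall>n. f n \<subset> f (Suc n))"
  then obtain f :: "nat \<Rightarrow> 'a set" where f: "\<And>n. f n \<in> \<B>" "\<And>n. f n \<subset> f (Suc n)"
    by blast
  have "strict_mono f"
    using f(2) by (simp add: strict_mono_Suc_iff)
  then have "infinite (range f)"
    using range_inj_infinite strict_mono_imp_inj_on by blast
  moreover have "range f \<subseteq> \<B>"
    using f(1) by blast
  ultimately show False
    using fin finite_subset by blast
qed

lemma RO_is_base:
  assumes "regular_space X"
  shows "is_base X (RO X)"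
  unfolding is_base_def
proof (intro conjI ballI allI impI)
  show "openin X B" if "B \<in> RO X" for B
    using that by (rule RO_openin)
  fix U x assume "openin X U \<and> x \<in> U"
  then obtain W where W: "W \<in> RO X" "x \<in> W" "X closure_of W \<subseteq> U"
    using regular_space_RO_base[OF assms] by metis
  then show "\<exists>B\<in>RO X. x \<in> B \<and> B \<subseteq> U"
    using RO_subset_closure[OF W(1)] by blast
qed

lemma infinite_RO_noetherian_base:
  assumes reg: "regular_space X" and X: "rho_homogeneous X" "infinite (RO X)"
  shows "\<exists>\<B>. \<B> \<subseteq> RO X \<and> is_base X \<B> \<and> noetherian_family \<B>"
proof -
  let ?N = "below X (topspace X)"
  have N_iff: "P \<in> ?N \<longleftrightarrow> P \<in> RO X \<and> P \<noteq> {}" for P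
    using RO_subset_topspace unfolding below_def by blast
  note atomless = infinite_homogeneous_atomless[OF X]
  have "\<forall>P\<in>?N. \<exists>N. \<exists>q. N \<in> below X P \<and> (\<forall>i. q i \<in> below X P \<and> N \<inter> q i = {}) \<and>
      X closure_of q True \<inter> X closure_of q False = {}"
  proof
    fix P assume "P \<in> ?N"
    then have P: "P \<in> RO X" "P \<noteq> {}" by (simp_all add: N_iff)
    obtain N q where "N \<in> below X P" "\<And>i. q i \<in> below X P" "\<And>i. N \<inter> q i = {}"
      "X closure_of q True \<inter> X closure_of q False = {}"
      using three_pieces[OF reg atomless P] by metis
    then show "\<exists>N q. N \<in> below X P \<and> (\<forall>i. q i \<in> below X P \<and> N \<inter> q i = {}) \<and>
      X closure_of q True \<inter> X closure_of q False = {}"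
      by (intro exI[of _ N] exI[of _ q]) simp
  qed
  from bchoice[OF this] obtain nx where "\<forall>P\<in>?N. \<exists>q. nx P \<in> below X P \<and>
      (\<forall>i. q i \<in> below X P \<and> nx P \<inter> q i = {}) \<and> X closure_of q True \<inter> X closure_of q False = {}" ..
  from bchoice[OF this] obtain q where nxq: "\<forall>P\<in>?N. nx P \<in> below X P \<and>
      (\<forall>i. q P i \<in> below X P \<and> nx P \<inter> q P i = {}) \<and>
      X closure_of q P True \<inter> X closure_of q P False = {}" ..
  have nx: "nx P \<in> below X P" and q: "q P i \<in> below X P" and nxq_disj: "nx P \<inter> q P i = {}"
    and q_disj: "X closure_of q P True \<inter> X closure_of q P False = {}" if "P \<in> ?N" for P i
    using nxq that by simp_all
  have "\<exists>h. \<forall>u\<in>RO X. h u \<in> RO X \<and> h u \<subseteq> Q \<and> (\<forall>v\<in>RO X. h u \<subseteq> h v \<longrightarrow> u = v)" if "Q \<in> ?N" for Q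
    using that RO_antichain_code[OF X] by (simp add: N_iff)
  then have "\<exists>h. \<forall>Q\<in>?N. \<forall>u\<in>RO X. h Q u \<in> RO X \<and> h Q u \<subseteq> Q \<and>
      (\<forall>v\<in>RO X. h Q u \<subseteq> h Q v \<longrightarrow> u = v)"
    by (intro bchoice) simp
  then obtain h where "\<forall>Q\<in>?N. \<forall>u\<in>RO X. h Q u \<in> RO X \<and> h Q u \<subseteq> Q \<and>
      (\<forall>v\<in>RO X. h Q u \<subseteq> h Q v \<longrightarrow> u = v)" ..
  then have h: "h Q u \<in> RO X" "h Q u \<subseteq> Q"
    and h_inj: "v \<in> RO X \<Longrightarrow> h Q u \<subseteq> h Q v \<Longrightarrow> u = v"
    if "Q \<in> ?N" "u \<in> RO X" for Q u v
    using that by simp_all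
  \<comment> \<open>A code equal to \<open>Q\<close> would contain every other code, against
    incomparability.\<close>
  have h_ne: "h Q u \<noteq> Q" if Q: "Q \<in> ?N" and u: "u \<in> RO X" for Q u
  proof
    assume eq: "h Q u = Q"
    have "\<not> RO X \<subseteq> {u}"
      using X(2) finite_subset by blast
    then obtain v where v: "v \<in> RO X" "v \<noteq> u" by blast
    have "h Q v \<subseteq> h Q u"
      using h(2)[OF Q v(1)] eq by simp
    then have "v = u" by (rule h_inj[OF Q v(1) u])
    with v(2) show False ..
  qed

  define p where "p P n = (nx ^^ n) P" for P n
  have p_N: "p P n \<in> ?N" if "P \<in> ?N" for P n
  proof (induction n)
    case 0
    then show ?case using that by (simp add: p_def)
  next
    case (Suc n)
    then show ?case
      using nx[OF Suc] below_mono[OF belowD(3)[OF Suc]] by (auto simp: p_def)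
  qed
  obtain r :: "'a set rel" where r: "well_order_on UNIV r"
    using well_order_on by blast
  \<comment> \<open>Sets are compared first, so \<open>(P, Suc n)\<close> is the immediate successor
    of \<open>(P, n)\<close>.\<close>
  define R where "R = (r - Id) <*lex*> less_than"
  have wf_R: "wf R"
    unfolding R_def using r by (intro wf_lex_prod wf_less_than) (simp add: well_order_on_def)
  have total_R: "s = s' \<or> (s, s') \<in> R \<or> (s', s) \<in> R" for s s'
  proof -
    have "total_on UNIV r"
      using r unfolding order_on_defs by blast
    then show ?thesis
      unfolding R_def total_on_def by (cases s; cases s') (auto simp: less_than_iff)
  qed
  define S where "S W = {(P, n). P \<in> ?N \<and> p P n \<subseteq> W}" for W
  have S_mono: "S W \<subseteq> S W'" if "W \<subseteq> W'" for W W'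
    using that unfolding S_def by blast
  have "\<exists>s. s \<in> S W \<and> (\<forall>s'. (s', s) \<in> R \<longrightarrow> s' \<notin> S W)" if "W \<in> ?N" for W
  proof -
    have "(W, 0) \<in> S W" using that by (simp add: S_def p_def)
    then show ?thesis using wfE_min[OF wf_R] by metis
  qed
  then have "\<exists>m. \<forall>W\<in>?N. m W \<in> S W \<and> (\<forall>s'. (s', m W) \<in> R \<longrightarrow> s' \<notin> S W)"
    by (intro bchoice) simp
  then obtain m where "\<forall>W\<in>?N. m W \<in> S W \<and> (\<forall>s'. (s', m W) \<in> R \<longrightarrow> s' \<notin> S W)" ..
  then have mS: "m W \<in> S W" and m_min: "(s', m W) \<in> R \<Longrightarrow> s' \<notin> S W" if "W \<in> ?N" for W s'
    using that by blast+
  have m_eqI: "m W = s" if "W \<in> ?N" "s \<in> S W" "\<And>s'. (s', s) \<in> R \<Longrightarrow> s' \<notin> S W" for W s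
    using total_R[of s "m W"] mS[OF that(1)] m_min[OF that(1), of s] that(2) that(3)[of "m W"]
    by blast
  define top where "top W = p (fst (m W)) (snd (m W))" for W
  \<comment> \<open>\<open>W\<close> is kept off the closure of \<open>Q\<close> and becomes its
    code inside \<open>Q\<close>; \<open>reg\<close> restores regular openness without changing the
    trace on \<open>Q\<close>.\<close>
  define C where "C W i = reg X ((W \<inter> ext X (q (top W) i)) \<union> h (q (top W) i) W)" for W i
  have top: "top W \<in> ?N" "top W \<subseteq> W" if "W \<in> ?N" for W
    using mS[OF that] p_N by (simp_all add: top_def S_def case_prod_beta)
  have Q: "q (top W) i \<in> ?N" "q (top W) i \<subseteq> top W" if "W \<in> ?N" for W i
    using subsetD[OF below_mono[OF belowD(3)[OF top(1)[OF that]]] q[OF top(1)[OF that]]]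
      belowD(3)[OF q[OF top(1)[OF that]]] .
  have C_RO: "C W i \<in> RO X" for W i
    unfolding C_def by (rule reg_RO)
  have C_sub: "C W i \<subseteq> W" if W: "W \<in> ?N" for W i
  proof -
    have "h (q (top W) i) W \<subseteq> W"
      using h(2)[OF Q(1)[OF W] belowD(1)[OF W]] Q(2)[OF W] top(2)[OF W] by blast
    then show ?thesis
      unfolding C_def using belowD(1)[OF W] by (intro reg_least) auto
  qed
  have sub_C: "W \<inter> ext X (q (top W) i) \<subseteq> C W i" if W: "W \<in> ?N" for W i
  proof -
    have "openin X ((W \<inter> ext X (q (top W) i)) \<union> h (q (top W) i) W)"
      by (intro openin_Un openin_Int openin_ext RO_openin belowD(1)[OF W]
          h(1)[OF Q(1)[OF W] belowD(1)[OF W]])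
    then show ?thesis
      unfolding C_def using subset_reg by blast
  qed
  have C_Q: "q (top W) i \<inter> C W i = h (q (top W) i) W" if W: "W \<in> ?N" for W i
    unfolding C_def
  proof (rule reg_Int_piece)
    show "openin X (q (top W) i)"
      using Q(1)[OF W] by (intro RO_openin belowD)
    then show "q (top W) i \<inter> ((W \<inter> ext X (q (top W) i)) \<union> h (q (top W) i) W) = h (q (top W) i) W"
      using ext_disjoint h(2)[OF Q(1)[OF W] belowD(1)[OF W]] by blast
    show "h (q (top W) i) W \<in> RO X"
      by (rule h(1)[OF Q(1)[OF W] belowD(1)[OF W]])
  qed
  have next_C: "nx (top W) \<subseteq> C W i" if W: "W \<in> ?N" for W i
  proof -
    have "nx (top W) \<subseteq> ext X (q (top W) i)"
      using nx[OF top(1)[OF W]] nxq_disj[OF top(1)[OF W]]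
      by (intro subset_ext RO_openin belowD(1))
    moreover have "nx (top W) \<subseteq> W"
      using belowD(3)[OF nx[OF top(1)[OF W]]] top(2)[OF W] by blast
    ultimately show ?thesis
      using sub_C[OF W] by blast
  qed
  have C_N: "C W i \<in> ?N" if W: "W \<in> ?N" for W i
    using next_C[OF W, of i] belowD(2)[OF nx[OF top(1)[OF W]]] C_RO[of W i]
    unfolding N_iff by blast
  \<comment> \<open>Pairs below \<open>m W\<close> stay excluded because
    \<open>C W i \<subseteq> W\<close>. The pair \<open>m W\<close> itself drops out because the
    code is a proper part of \<open>Q\<close>, while the next set of the chain avoids
    \<open>Q\<close> and survives.\<close>
  have m_C: "m (C W i) = (fst (m W), Suc (snd (m W)))" if W: "W \<in> ?N" for W i
  proof (rule m_eqI[OF C_N[OF W]])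
    obtain P n where mW: "m W = (P, n)" by (cases "m W")
    then have P: "P \<in> ?N" and topW: "top W = p P n"
      using mS[OF W] by (simp_all add: S_def top_def)
    show "(fst (m W), Suc (snd (m W))) \<in> S (C W i)"
      using next_C[OF W, of i] P unfolding S_def mW topW by (simp add: p_def)
    fix s assume s: "(s, (fst (m W), Suc (snd (m W)))) \<in> R"
    show "s \<notin> S (C W i)"
    proof
      assume sC: "s \<in> S (C W i)"
      then have "s \<in> S W"
        using S_mono[OF C_sub[OF W]] by blast
      then have "(s, m W) \<notin> R"
        using m_min[OF W] by blast
      then have "s = m W"
        using s unfolding R_def mW by (cases s) auto
      then have "top W \<subseteq> C W i"
        using sC by (simp add: S_def mW topW)
      then have "h (q (top W) i) W = q (top W) i"
        using C_Q[OF W, of i] Q(2)[OF W, of i] by blast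
      then show False
        using h_ne[OF Q(1)[OF W] belowD(1)[OF W]] by blast
    qed
  qed

  let ?\<B> = "{C W i |W i. W \<in> ?N}"
  have "is_base X ?\<B>"
    unfolding is_base_def
  proof (intro conjI ballI allI impI)
    show "openin X B" if "B \<in> ?\<B>" for B
      using that C_RO RO_openin by blast
    fix U x assume U: "openin X U \<and> x \<in> U"
    then obtain W where W: "W \<in> RO X" "x \<in> W" "X closure_of W \<subseteq> U"
      using regular_space_RO_base[OF reg] by metis
    then have WN: "W \<in> ?N" by (auto simp: N_iff)
    \<comment> \<open>Each point avoids one of the two disjoint closures; hence the two
      modifications of every \<open>W\<close>.\<close>
    obtain i where "x \<notin> X closure_of q (top W) i"
      using q_disj[OF top(1)[OF WN]] by blast
    then have "x \<in> ext X (q (top W) i)"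
      using W(2) RO_subset_topspace[OF W(1)] unfolding ext_def by blast
    then have "x \<in> C W i"
      using sub_C[OF WN] W(2) by blast
    moreover have "C W i \<subseteq> U"
      using C_sub[OF WN, of i] RO_subset_closure[OF W(1)] W(3) by blast
    ultimately show "\<exists>B\<in>?\<B>. x \<in> B \<and> B \<subseteq> U"
      using WN by blast
  qed
  moreover have "noetherian_family ?\<B>"
    unfolding noetherian_family_def
  proof
    assume "\<exists>f :: nat \<Rightarrow> 'a set. (\<forall>n. f n \<in> ?\<B>) \<and> (\<forall>n. f n \<subset> f (Suc n))"
    then obtain f :: "nat \<Rightarrow> 'a set" where fB: "\<forall>k. \<exists>W i. f k = C W i \<and> W \<in> ?N"
      and f: "\<And>k. f k \<subset> f (Suc k)"
      by blast
    from choice[OF fB] obtain W where "\<forall>k. \<exists>i. f k = C (W k) i \<and> W k \<in> ?N" ..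
    from choice[OF this] obtain i where "\<forall>k. f k = C (W k) (i k) \<and> W k \<in> ?N" ..
    then have fC: "\<And>k. f k = C (W k) (i k)" and WN: "\<And>k. W k \<in> ?N"
      by simp_all
    have "(m (f (Suc k)), m (f k)) \<in> R \<or> m (f (Suc k)) = m (f k)" for k
    proof -
      have fN: "f k \<in> ?N" "f (Suc k) \<in> ?N"
        unfolding fC by (intro C_N WN)+
      \<comment> \<open>A larger set has a larger \<open>S\<close>, so its least pair cannot be
        later.\<close>
      have "m (f k) \<in> S (f (Suc k))"
        using mS[OF fN(1)] S_mono[of "f k" "f (Suc k)"] f by blast
      then have "(m (f k), m (f (Suc k))) \<notin> R"
        using m_min[OF fN(2)] by blast
      then show ?thesis
        using total_R by blast
    qed
    then obtain K where K: "\<And>k. k \<ge> K \<Longrightarrow> m (f k) = m (f K)"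
      using wf_descending_stabilises[OF wf_R, of "\<lambda>k. m (f k)"] by blast
    \<comment> \<open>Undoing the shift by one in \<open>m_C\<close> recovers \<open>m (W k)\<close>
      from \<open>m (f k)\<close>.\<close>
    have mW: "m (W k) = m (W K)" if "k \<ge> K" for k
      using K[OF that] unfolding fC by (simp add: m_C[OF WN] prod_eq_iff)
    have topW: "top (W k) = top (W K)" if "k \<ge> K" for k
      using mW[OF that] by (simp add: top_def)
    have strict: "f j \<subset> f k" if "j < k" for j k
      using f that by (rule lift_Suc_mono_less)
    \<comment> \<open>Both members have their codes in the same \<open>Q\<close>; comparable codes
      force \<open>W j = W k\<close>, hence \<open>f j = f k\<close>.\<close>
    have False if jk: "K \<le> j" "j < k" "i j = i k" for j k
    proof -
      let ?Q = "q (top (W K)) (i k)"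
      have "?Q \<inter> f j = h ?Q (W j)" "?Q \<inter> f k = h ?Q (W k)"
        using C_Q[OF WN, of j "i j"] C_Q[OF WN, of k "i k"] jk topW[of j] topW[of k]
        unfolding fC by simp_all
      then have "h ?Q (W j) \<subseteq> h ?Q (W k)"
        using strict[OF jk(2)] by blast
      then have "W j = W k"
        by (rule h_inj[OF Q(1)[OF WN] belowD(1)[OF WN] belowD(1)[OF WN]])
      then show False
        using strict[OF jk(2)] jk(3) unfolding fC by simp
    qed
    \<comment> \<open>Among three indices two carry the same truth value.\<close>
    from this[of K "Suc K"] this[of K "Suc (Suc K)"] this[of "Suc K" "Suc (Suc K)"]
    show False by auto
  qed
  ultimately show ?thesis
    using C_RO by (intro exI[of _ ?\<B>]) blast
qed

unbundle no cardinal_syntax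

theorem theorem2:
  fixes X :: "'a topology"
  assumes "t1_space X" and "regular_space X"
    and "rho_homogeneous X"
  shows "\<exists>\<B>. \<B> \<subseteq> regular_open_sets X \<and> is_base X \<B> \<and> noetherian_family \<B>"
proof (cases "finite (RO X)")
  \<comment> \<open>The coding needs infinitely many regular open sets; a finite \<open>RO X\<close>
    is itself a Noetherian base.\<close>
  case True
  then show ?thesis
    using RO_is_base[OF assms(2)] finite_noetherian_family by blast
next
  case False
  then show ?thesis
    by (rule infinite_RO_noetherian_base[OF assms(2,3)])
qed

end
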